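(* Let $G = K \rtimes_\theta Q \neq 1$ and let $O_\theta$ be the union of all finite $\theta(Q)$-orbits in $K$. Then $G$ is icc if and only if all of the following hold: \begin{itemize} \item[(a)] $O_\theta \cap FC(K) = \{1\}$; \item[(b)] $O_\theta \cap \pi_K^{-1}(\theta(FC(Q))) = \{1\}$; \item[(c)] the restricted homomorphism $\theta : FC(Q) \to \mathrm{Aut}(K)$ is injective. \end{itemize}
   Context: A group is icc (has infinite conjugacy classes) if it is non-trivial and all its conjugacy classes other than $\{1\}$ are infinite. For a group $H$, $FC(H)$ denotes the (characteristic) subgroup of all elements of $H$ whose conjugacy class in $H$ is finite. $G = K \rtimes_\theta Q$ denotes the split extension (semi-direct product) with normal factor $K$, retract factor $Q$ (both viewed as subgroups of $G$) and associated homomorphism $\theta : Q \to \mathrm{Aut}(K)$, with the convention $q^{-1} k q = \theta(q)(k)$ for $k \in K$, $q \in Q$. The homomorphism $\pi_K : K \to \mathrm{Inn}(K) \le \mathrm{Aut}(K)$ is the natural one, $\pi_K(k)(x) = k^{-1} x k$. (Composition in $\mathrm{Aut}(K)$ is taken in the order that makes these maps homomorphisms.) $\theta(Q)$-orbits are those of the natural action of $\theta(Q) \le \mathrm{Aut}(K)$ on $K$. *)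

theory Defs
  imports "HOL-Algebra.Algebra"
begin

definition conj_action :: "('a, 'm) monoid_scheme \<Rightarrow> 'a \<Rightarrow> 'a \<Rightarrow> 'a"
  where "conj_action G g = (\<lambda>x\<in>carrier G. g \<otimes>\<^bsub>G\<^esub> x \<otimes>\<^bsub>G\<^esub> inv\<^bsub>G\<^esub> g)"

abbreviation conj_class :: "('a, 'm) monoid_scheme \<Rightarrow> 'a \<Rightarrow> 'a set"
  where "conj_class G x \<equiv> orbit G (conj_action G) x"

abbreviation conj_classes :: "('a, 'm) monoid_scheme \<Rightarrow> 'a set set"
  where "conj_classes G \<equiv> orbits G (carrier G) (conj_action G)"

definition icc :: "('a, 'm) monoid_scheme \<Rightarrow> bool"
  where "icc G \<longleftrightarrow> carrier G \<noteq> {\<one>\<^bsub>G\<^esub>} \<and>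
                  (\<forall>C \<in> conj_classes G. C \<noteq> {\<one>\<^bsub>G\<^esub>} \<longrightarrow> infinite C)"

definition FC :: "('a, 'm) monoid_scheme \<Rightarrow> 'a set"
  where "FC H = {x \<in> carrier H. finite (conj_class H x)}"

text \<open>
  The automorphism group with the reversed product, \<open>f \<otimes> g = g \<circ> f\<close> (first \<open>f\<close>, then \<open>g\<close>).
  The library's \<open>AutoGroup\<close> has \<open>f \<otimes> g = f \<circ> g\<close>, for which \<open>k \<mapsto> (x \<mapsto> k\<inverse> x k)\<close>
  would be an antihomomorphism.
\<close>
definition Aut :: "('a, 'm) monoid_scheme \<Rightarrow> ('a \<Rightarrow> 'a) monoid"
  where "Aut K = (AutoGroup K)\<lparr>mult := \<lambda>f g. g \<otimes>\<^bsub>AutoGroup K\<^esub> f\<rparr>"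

definition inner_aut :: "('a, 'm) monoid_scheme \<Rightarrow> 'a \<Rightarrow> 'a \<Rightarrow> 'a"
  where "inner_aut K k = (\<lambda>x\<in>carrier K. inv\<^bsub>K\<^esub> k \<otimes>\<^bsub>K\<^esub> x \<otimes>\<^bsub>K\<^esub> k)"

text \<open>The union of the finite orbits in \<open>K\<close> of a set (subgroup) \<open>A\<close> of automorphisms of \<open>K\<close>.\<close>
definition finite_orbits_union :: "('a, 'm) monoid_scheme \<Rightarrow> ('a \<Rightarrow> 'a) set \<Rightarrow> 'a set"
  where "finite_orbits_union K A =
           \<Union>{S \<in> orbits ((Aut K)\<lparr>carrier := A\<rparr>) (carrier K) (\<lambda>\<alpha>. \<alpha>). finite S}"

text \<open>
  \<open>G = K \<rtimes> Q\<close>, with both factors viewed as subgroups of \<open>G\<close>; \<open>\<theta>\<close> matters only on \<open>Q\<close>.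
\<close>
locale split_extension = K: normal K G + Q: subgroup Q G
  for G (structure) and K and Q +
  fixes \<theta> :: "'a \<Rightarrow> 'a \<Rightarrow> 'a"
  assumes inter_trivial: "K \<inter> Q = {\<one>}"
    and product_eq: "K <#> Q = carrier G"
    and theta_hom: "\<theta> \<in> hom (G\<lparr>carrier := Q\<rparr>) (Aut (G\<lparr>carrier := K\<rparr>))"
    and theta_conj: "\<lbrakk>q \<in> Q; k \<in> K\<rbrakk> \<Longrightarrow> inv q \<otimes> k \<otimes> q = \<theta> q k"

lemma carrier_Aut [simp]: "carrier (Aut K) = auto K"
  by (simp add: Aut_def AutoGroup_def)

lemma one_Aut [simp]: "\<one>\<^bsub>Aut K\<^esub> = (\<lambda>x\<in>carrier K. x)"
  by (simp add: Aut_def AutoGroup_def BijGroup_def)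

lemma mult_Aut: "\<lbrakk>f \<in> auto K; g \<in> auto K\<rbrakk> \<Longrightarrow> f \<otimes>\<^bsub>Aut K\<^esub> g = compose (carrier K) g f"
  by (simp add: Aut_def AutoGroup_def BijGroup_def auto_def)

lemma (in group) group_Aut: "group (Aut G)"
proof -
  interpret A: group "AutoGroup G" by (rule AutoGroup)
  show ?thesis
  proof (rule groupI)
    fix x assume "x \<in> carrier (Aut G)"
    then have "x \<in> carrier (AutoGroup G)" by (simp add: Aut_def)
    then show "\<exists>y\<in>carrier (Aut G). y \<otimes>\<^bsub>Aut G\<^esub> x = \<one>\<^bsub>Aut G\<^esub>"
      by (intro bexI[of _ "inv\<^bsub>AutoGroup G\<^esub> x"]) (simp_all add: Aut_def del: carrier_Aut one_Aut)
  qed (simp_all add: Aut_def A.m_assoc del: carrier_Aut one_Aut)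
qed

lemma (in normal) conj_hom_Aut:
  "(\<lambda>g. \<lambda>x\<in>H. inv g \<otimes> x \<otimes> g) \<in> hom G (Aut (G\<lparr>carrier := H\<rparr>))"
proof -
  let ?t = "\<lambda>g. \<lambda>x\<in>H. inv g \<otimes> x \<otimes> g"
  have cl: "inv g \<otimes> x \<otimes> g \<in> H" "g \<otimes> x \<otimes> inv g \<in> H" if "g \<in> carrier G" "x \<in> H" for g x
    using that inv_op_closed1 inv_op_closed2 by auto
  have cancel: "inv g \<otimes> (g \<otimes> x) = x" "g \<otimes> (inv g \<otimes> x) = x"
    if "g \<in> carrier G" "x \<in> carrier G" for g x
    using that by (metis inv_closed l_inv l_one m_assoc, metis inv_closed r_inv l_one m_assoc)
  have auto: "?t g \<in> auto (G\<lparr>carrier := H\<rparr>)" if g: "g \<in> carrier G" for g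
  proof -
    have "bij_betw (?t g) H H"
    proof (rule bij_betwI[where g = "\<lambda>x. g \<otimes> x \<otimes> inv g"])
      fix x assume "x \<in> H"
      with g show "g \<otimes> ?t g x \<otimes> inv g = x" "?t g (g \<otimes> x \<otimes> inv g) = x"
        by (simp_all add: cl) (simp_all add: m_assoc cancel)
    qed (use g in \<open>simp_all add: cl Pi_iff\<close>)
    moreover have "inv g \<otimes> (x \<otimes> y) \<otimes> g = inv g \<otimes> x \<otimes> g \<otimes> (inv g \<otimes> y \<otimes> g)"
      if "x \<in> H" "y \<in> H" for x y
      using g that by (simp add: m_assoc cancel)
    ultimately show ?thesis
      using g by (auto simp: auto_def Bij_def hom_def cl)
  qed
  have "?t (g \<otimes> h) = compose H (?t h) (?t g)" if "g \<in> carrier G" "h \<in> carrier G" for g h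
    using that by (auto simp: compose_def cl inv_mult_group intro!: restrict_ext) (simp add: m_assoc)
  with auto show ?thesis
    by (auto simp: hom_def mult_Aut)
qed

lemma (in group) inner_aut_hom: "inner_aut G \<in> hom G (Aut G)"
proof -
  interpret N: normal "carrier G" G
    by (simp add: normal_inv_iff subgroup_self)
  show ?thesis
    using N.conj_hom_Aut by (simp add: inner_aut_def[abs_def])
qed

text \<open>Every internal semidirect decomposition is a split extension.\<close>
lemma split_extension_conj:
  assumes "K \<lhd> G" "subgroup Q G" "K \<inter> Q = {\<one>\<^bsub>G\<^esub>}" "K <#>\<^bsub>G\<^esub> Q = carrier G"
  shows "split_extension G K Q (\<lambda>q. \<lambda>k\<in>K. inv\<^bsub>G\<^esub> q \<otimes>\<^bsub>G\<^esub> k \<otimes>\<^bsub>G\<^esub> q)"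
proof -
  interpret normal K G by fact
  interpret Q: subgroup Q G by fact
  show ?thesis
    using assms conj_hom_Aut by unfold_locales (simp_all add: hom_def Pi_iff Q.mem_carrier)
qed

end

theory Submission
  imports Defs
begin

text \<open>
  \<^emph>\<open>Idea of the proof.\<close> A non-trivial group is icc exactly when no element other than \<open>\<one>\<close> has a
  finite conjugacy class. In \<open>G = K Q\<close>, the class of \<open>g = k q\<close> is finite if and only if the
  conjugates of \<open>g\<close> by \<open>K\<close> and those by \<open>Q\<close> are finite in number (lemma
  \<open>finite_conjugates_by_product\<close>), and the latter means that \<open>k\<close> and \<open>q\<close> both have finitely many
  conjugates by \<open>Q\<close> (lemma \<open>finite_conjugates_by_retract\<close>). Moreover, two elements of \<open>G\<close> induce
  the same automorphism of \<open>K\<close> if and only if their quotient centralizes \<open>K\<close> (lemma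
  \<open>conj_eq_on_iff_centralizes\<close>). Each of (a), (b), (c)
  is therefore a statement about elements with a finite class: an offending element
  of (a) is itself such an element, one of (b) yields \<open>k q\<inverse>\<close> and one of (c) yields \<open>p q\<inverse>\<close>, the
  last two having finite classes because \<open>K\<close> centralizes them and their factors have finitely many
  conjugates by \<open>Q\<close>. So icc implies the three conditions.

  Conversely, let \<open>g = k q\<close> have a finite class. For \<open>x \<in> K\<close> the commutator of \<open>g\<close> and \<open>x\<close> lies in
  \<open>K\<close> and again has a finite class, so it is trivial by (a). Hence \<open>g\<close> centralizes \<open>K\<close>, that is,
  \<open>k\<close> and \<open>q\<inverse>\<close> act alike on \<open>K\<close>. Now (b) forces \<open>k = \<one>\<close>, and then \<open>q = g\<close> acts trivially on \<open>K\<close>,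
  so that (c) forces \<open>q = \<one>\<close>.
\<close>

section \<open>Conjugates by a subset of a group\<close>

definition conjugates_by :: "('a, 'm) monoid_scheme \<Rightarrow> 'a set \<Rightarrow> 'a \<Rightarrow> 'a set"
  where "conjugates_by G A x = (\<lambda>a. a \<otimes>\<^bsub>G\<^esub> x \<otimes>\<^bsub>G\<^esub> inv\<^bsub>G\<^esub> a) ` A"

definition centralizes :: "('a, 'm) monoid_scheme \<Rightarrow> 'a set \<Rightarrow> 'a \<Rightarrow> bool"
  where "centralizes G A g \<longleftrightarrow> (\<forall>x\<in>A. g \<otimes>\<^bsub>G\<^esub> x = x \<otimes>\<^bsub>G\<^esub> g)"

lemma conjugates_by_mono: "A \<subseteq> B \<Longrightarrow> conjugates_by G A x \<subseteq> conjugates_by G B x"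
  by (auto simp: conjugates_by_def)

context group
begin

lemma cancel_left:
  assumes "a \<in> carrier G" "x \<in> carrier G"
  shows "inv a \<otimes> (a \<otimes> x) = x" "a \<otimes> (inv a \<otimes> x) = x"
  using assms by (simp_all flip: m_assoc)

lemma conj_class_eq_conjugates_by:
  "x \<in> carrier G \<Longrightarrow> conj_class G x = conjugates_by G (carrier G) x"
  by (auto simp: orbit_def conj_action_def conjugates_by_def)

lemma FC_subgroup_eq:
  assumes "subgroup H G"
  shows "FC (G\<lparr>carrier := H\<rparr>) = {x \<in> H. finite (conjugates_by G H x)}"
proof -
  have "conj_class (G\<lparr>carrier := H\<rparr>) x = conjugates_by G H x" if "x \<in> H" for x
    using that m_inv_consistent[OF assms]
    by (force simp: orbit_def conj_action_def conjugates_by_def)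
  then show ?thesis
    by (auto simp: FC_def)
qed

lemma icc_iff:
  "icc G \<longleftrightarrow> carrier G \<noteq> {\<one>} \<and>
     (\<forall>x\<in>carrier G. finite (conjugates_by G (carrier G) x) \<longrightarrow> x = \<one>)"
proof -
  have "x \<in> conjugates_by G (carrier G) x" if "x \<in> carrier G" for x
    using that by (auto simp: conjugates_by_def image_iff intro!: bexI[of _ \<one>])
  moreover have "conjugates_by G (carrier G) \<one> = {\<one>}"
    by (auto simp: conjugates_by_def image_iff)
  ultimately have "conjugates_by G (carrier G) x = {\<one>} \<longleftrightarrow> x = \<one>" if "x \<in> carrier G" for x
    using that by blast
  moreover have "conj_classes G = conjugates_by G (carrier G) ` carrier G"
    by (force simp: orbits_def conj_class_eq_conjugates_by)
  ultimately show ?thesis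
    unfolding icc_def by simp blast
qed

lemma finite_conjugates_by_one:
  "A \<subseteq> carrier G \<Longrightarrow> finite (conjugates_by G A \<one>)"
  by (rule finite_subset[of _ "{\<one>}"]) (auto simp: conjugates_by_def subset_iff)

lemma finite_conjugates_by_mult:
  assumes "A \<subseteq> carrier G" "x \<in> carrier G" "y \<in> carrier G"
    and "finite (conjugates_by G A x)" "finite (conjugates_by G A y)"
  shows "finite (conjugates_by G A (x \<otimes> y))"
proof (rule finite_subset)
  have "a \<otimes> (x \<otimes> y) \<otimes> inv a = (a \<otimes> x \<otimes> inv a) \<otimes> (a \<otimes> y \<otimes> inv a)" if "a \<in> A" for a
    using that assms by (simp add: m_assoc cancel_left subset_iff)
  then show "conjugates_by G A (x \<otimes> y) \<subseteq>
      (\<lambda>(u, v). u \<otimes> v) ` (conjugates_by G A x \<times> conjugates_by G A y)"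
    by (fastforce simp: conjugates_by_def)
qed (use assms in simp)

lemma finite_conjugates_by_inv:
  assumes "A \<subseteq> carrier G" "x \<in> carrier G" "finite (conjugates_by G A x)"
  shows "finite (conjugates_by G A (inv x))"
proof (rule finite_subset)
  have "a \<otimes> inv x \<otimes> inv a = inv (a \<otimes> x \<otimes> inv a)" if "a \<in> A" for a
    using that assms by (simp add: m_assoc inv_mult_group subset_iff)
  then show "conjugates_by G A (inv x) \<subseteq> m_inv G ` conjugates_by G A x"
    by (auto simp: conjugates_by_def)
qed (use assms in simp)

lemma finite_conjugates_by_conj:
  assumes "x \<in> carrier G" "g \<in> carrier G" "finite (conjugates_by G (carrier G) x)"
  shows "finite (conjugates_by G (carrier G) (g \<otimes> x \<otimes> inv g))"
proof (rule finite_subset)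
  have "a \<otimes> (g \<otimes> x \<otimes> inv g) \<otimes> inv a = (a \<otimes> g) \<otimes> x \<otimes> inv (a \<otimes> g)" if "a \<in> carrier G" for a
    using that assms by (simp add: m_assoc inv_mult_group)
  then show "conjugates_by G (carrier G) (g \<otimes> x \<otimes> inv g) \<subseteq> conjugates_by G (carrier G) x"
    using assms by (auto simp: conjugates_by_def)
qed fact

lemma finite_conjugates_by_if_centralizes:
  assumes "A \<subseteq> carrier G" "g \<in> carrier G" "centralizes G A g"
  shows "finite (conjugates_by G A g)"
proof (rule finite_subset)
  have "a \<otimes> g \<otimes> inv a = g" if "a \<in> A" for a
  proof -
    have "a \<otimes> g = g \<otimes> a"
      using assms that by (simp add: centralizes_def)
    then show ?thesis
      using assms that by (simp add: m_assoc subset_iff)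
  qed
  then show "conjugates_by G A g \<subseteq> {g}"
    by (auto simp: conjugates_by_def)
qed simp

text \<open>
  Both sides say that the conjugations \<open>x \<mapsto> a\<inverse> x a\<close> and \<open>x \<mapsto> b\<inverse> x b\<close> agree on \<open>A\<close>. This turns
  equality of automorphisms induced on a normal subgroup into a property of one group element.
\<close>
lemma conj_eq_on_iff_centralizes:
  assumes "A \<subseteq> carrier G" "a \<in> carrier G" "b \<in> carrier G"
  shows "(\<lambda>x\<in>A. inv a \<otimes> x \<otimes> a) = (\<lambda>x\<in>A. inv b \<otimes> x \<otimes> b) \<longleftrightarrow> centralizes G A (a \<otimes> inv b)"
proof -
  have "inv a \<otimes> x \<otimes> a = inv b \<otimes> x \<otimes> b \<longleftrightarrow> a \<otimes> inv b \<otimes> x = x \<otimes> (a \<otimes> inv b)"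
    if "x \<in> carrier G" for x
  proof -
    have "inv a \<otimes> x \<otimes> a = inv b \<otimes> x \<otimes> b \<longleftrightarrow>
        a \<otimes> (inv a \<otimes> x \<otimes> a) \<otimes> inv b = a \<otimes> (inv b \<otimes> x \<otimes> b) \<otimes> inv b"
      using assms that by simp
    also have "\<dots> \<longleftrightarrow> x \<otimes> (a \<otimes> inv b) = a \<otimes> inv b \<otimes> x"
      using assms that by (simp add: m_assoc cancel_left)
    finally show ?thesis by auto
  qed
  moreover have "(\<lambda>x\<in>A. inv a \<otimes> x \<otimes> a) = (\<lambda>x\<in>A. inv b \<otimes> x \<otimes> b) \<longleftrightarrow>
      (\<forall>x\<in>A. inv a \<otimes> x \<otimes> a = inv b \<otimes> x \<otimes> b)"
    by (auto simp: restrict_def fun_eq_iff)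
  ultimately show ?thesis
    using assms(1) unfolding centralizes_def by blast
qed

end

section \<open>Finite classes in a split extension\<close>

context split_extension
begin

lemma in_carrier [simp]:
  "x \<in> K \<Longrightarrow> x \<in> carrier G" "x \<in> Q \<Longrightarrow> x \<in> carrier G"
  by (rule K.mem_carrier, assumption) (rule Q.mem_carrier)

text \<open>
  Conjugating by \<open>k q\<close> means conjugating by \<open>q\<close> and then by \<open>k\<close>; since \<open>K\<close> is normal, every
  conjugate of \<open>x\<close> has as many conjugates by \<open>K\<close> as \<open>x\<close> itself.
\<close>
lemma finite_conjugates_by_product:
  assumes "x \<in> carrier G"
  shows "finite (conjugates_by G (carrier G) x) \<longleftrightarrow>
    finite (conjugates_by G K x) \<and> finite (conjugates_by G Q x)"
proof
  assume "finite (conjugates_by G (carrier G) x)"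
  then show "finite (conjugates_by G K x) \<and> finite (conjugates_by G Q x)"
    by (meson K.subset Q.subset conjugates_by_mono finite_subset)
next
  assume fin: "finite (conjugates_by G K x) \<and> finite (conjugates_by G Q x)"
  have fin_K: "finite (conjugates_by G K (q \<otimes> x \<otimes> inv q))" if "q \<in> Q" for q
  proof (rule finite_subset)
    have "k \<otimes> (q \<otimes> x \<otimes> inv q) \<otimes> inv k =
        q \<otimes> ((inv q \<otimes> k \<otimes> q) \<otimes> x \<otimes> inv (inv q \<otimes> k \<otimes> q)) \<otimes> inv q" if "k \<in> K" for k
      using that \<open>q \<in> Q\<close> assms by (simp add: K.m_assoc K.inv_mult_group K.cancel_left)
    moreover have "inv q \<otimes> k \<otimes> q \<in> K" if "k \<in> K" for k
      using that \<open>q \<in> Q\<close> K.inv_op_closed1 by simp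
    ultimately show "conjugates_by G K (q \<otimes> x \<otimes> inv q) \<subseteq>
        (\<lambda>y. q \<otimes> y \<otimes> inv q) ` conjugates_by G K x"
      by (fastforce simp: conjugates_by_def)
  qed (use fin in simp)
  have "finite (\<Union>y\<in>conjugates_by G Q x. conjugates_by G K y)"
  proof (rule finite_UN_I)
    show "finite (conjugates_by G K y)" if "y \<in> conjugates_by G Q x" for y
      using that fin_K unfolding conjugates_by_def[of G Q] by blast
  qed (use fin in simp)
  moreover have "conjugates_by G (carrier G) x \<subseteq>
      (\<Union>y\<in>conjugates_by G Q x. conjugates_by G K y)"
  proof
    fix z assume "z \<in> conjugates_by G (carrier G) x"
    then obtain k q where "k \<in> K" "q \<in> Q" and "z = (k \<otimes> q) \<otimes> x \<otimes> inv (k \<otimes> q)"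
      by (auto simp: conjugates_by_def set_mult_def simp flip: product_eq)
    then have "z = k \<otimes> (q \<otimes> x \<otimes> inv q) \<otimes> inv k"
      using assms by (simp add: K.m_assoc K.inv_mult_group)
    with \<open>k \<in> K\<close> \<open>q \<in> Q\<close>
    show "z \<in> (\<Union>y\<in>conjugates_by G Q x. conjugates_by G K y)"
      by (auto simp: conjugates_by_def)
  qed
  ultimately show "finite (conjugates_by G (carrier G) x)"
    by (rule finite_subset[rotated])
qed

lemma factorization_unique:
  assumes "k \<in> K" "k' \<in> K" "q \<in> Q" "q' \<in> Q" "k \<otimes> q = k' \<otimes> q'"
  shows "k = k' \<and> q = q'"
proof -
  have "inv k' \<otimes> k = inv k' \<otimes> (k \<otimes> q) \<otimes> inv q"
    using assms(1-4) by (simp add: K.m_assoc)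
  also have "\<dots> = q' \<otimes> inv q"
    using assms by (simp add: K.cancel_left flip: K.m_assoc)
  finally have eq: "inv k' \<otimes> k = q' \<otimes> inv q" .
  moreover have "inv k' \<otimes> k \<in> K" "q' \<otimes> inv q \<in> Q"
    using assms by simp_all
  ultimately have "inv k' \<otimes> k = \<one>" "q' \<otimes> inv q = \<one>"
    using inter_trivial by auto
  then show ?thesis
    using assms by (metis in_carrier K.inv_equality K.inv_inv K.inv_closed)
qed

text \<open>
  Conjugation by an element of \<open>Q\<close> preserves both factors, so the two components of a conjugate
  of \<open>k q\<close> are the conjugates of \<open>k\<close> and \<open>q\<close>.
\<close>
lemma finite_conjugates_by_retract:
  assumes "k \<in> K" "q \<in> Q"
  shows "finite (conjugates_by G Q (k \<otimes> q)) \<longleftrightarrow>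
    finite (conjugates_by G Q k) \<and> finite (conjugates_by G Q q)"
proof
  let ?P = "(\<lambda>r. (r \<otimes> k \<otimes> inv r, r \<otimes> q \<otimes> inv r)) ` Q"
  assume fin: "finite (conjugates_by G Q (k \<otimes> q))"
  have sub: "?P \<subseteq> K \<times> Q"
    using assms K.inv_op_closed2 by auto
  have "r \<otimes> (k \<otimes> q) \<otimes> inv r = (r \<otimes> k \<otimes> inv r) \<otimes> (r \<otimes> q \<otimes> inv r)" if "r \<in> Q" for r
    using that assms by (simp add: K.m_assoc K.cancel_left)
  then have "(\<lambda>(u, v). u \<otimes> v) ` ?P = conjugates_by G Q (k \<otimes> q)"
    by (auto simp: conjugates_by_def image_image intro!: image_cong)
  moreover have "inj_on (\<lambda>(u, v). u \<otimes> v) ?P"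
    using factorization_unique by (intro inj_on_subset[OF _ sub]) (auto simp: inj_on_def)
  ultimately have "finite ?P"
    using fin finite_imageD[of "\<lambda>(u, v). u \<otimes> v" ?P] by simp
  then have "finite (fst ` ?P)" "finite (snd ` ?P)"
    by (rule finite_imageI)+
  then show "finite (conjugates_by G Q k) \<and> finite (conjugates_by G Q q)"
    by (simp add: conjugates_by_def image_image)
next
  assume "finite (conjugates_by G Q k) \<and> finite (conjugates_by G Q q)"
  then show "finite (conjugates_by G Q (k \<otimes> q))"
    using assms by (intro K.finite_conjugates_by_mult) auto
qed

section \<open>The three conditions in terms of conjugation in the extension\<close>

lemma theta_eq: "q \<in> Q \<Longrightarrow> \<theta> q = (\<lambda>x\<in>K. inv q \<otimes> x \<otimes> q)"
proof -
  assume q: "q \<in> Q"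
  then have "\<theta> q \<in> extensional K"
    using theta_hom by (auto simp: hom_def auto_def Bij_def Pi_iff)
  with q show ?thesis
    by (auto simp: theta_conj extensional_def restrict_def)
qed

lemma inner_aut_eq: "k \<in> K \<Longrightarrow> inner_aut (G\<lparr>carrier := K\<rparr>) k = (\<lambda>x\<in>K. inv k \<otimes> x \<otimes> k)"
  using K.m_inv_consistent[OF K.subgroup_axioms] by (simp add: inner_aut_def)

lemma inner_aut_eq_theta_iff:
  "\<lbrakk>k \<in> K; q \<in> Q\<rbrakk> \<Longrightarrow>
    inner_aut (G\<lparr>carrier := K\<rparr>) k = \<theta> q \<longleftrightarrow> centralizes G K (k \<otimes> inv q)"
  using K.conj_eq_on_iff_centralizes[OF K.subset] by (simp add: inner_aut_eq theta_eq)

lemma theta_eq_theta_iff: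
  "\<lbrakk>p \<in> Q; q \<in> Q\<rbrakk> \<Longrightarrow> \<theta> p = \<theta> q \<longleftrightarrow> centralizes G K (p \<otimes> inv q)"
  using K.conj_eq_on_iff_centralizes[OF K.subset] by (simp add: theta_eq)

text \<open>
  The action is \<open>k \<mapsto> q\<inverse> k q\<close>, but as \<open>q\<close> runs over the subgroup \<open>Q\<close> so does \<open>q\<inverse>\<close>.
\<close>
lemma theta_orbit_eq:
  assumes "k \<in> K"
  shows "orbit ((Aut (G\<lparr>carrier := K\<rparr>))\<lparr>carrier := \<theta> ` Q\<rparr>) (\<lambda>\<alpha>. \<alpha>) k = conjugates_by G Q k"
proof -
  have "orbit ((Aut (G\<lparr>carrier := K\<rparr>))\<lparr>carrier := \<theta> ` Q\<rparr>) (\<lambda>\<alpha>. \<alpha>) k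
      = (\<lambda>q. inv q \<otimes> k \<otimes> q) ` Q"
    using assms by (auto simp: orbit_def theta_conj image_iff)
  also have "\<dots> = (\<lambda>q. inv q \<otimes> k \<otimes> q) ` m_inv G ` Q"
  proof -
    have "q \<in> m_inv G ` Q" if "q \<in> Q" for q
      using that by (intro image_eqI[of _ _ "inv q"]) simp_all
    then have "m_inv G ` Q = Q"
      by auto
    then show ?thesis
      by simp
  qed
  also have "\<dots> = conjugates_by G Q k"
    by (simp add: conjugates_by_def image_image cong: image_cong)
  finally show ?thesis .
qed

lemma finite_orbits_union_eq:
  "finite_orbits_union (G\<lparr>carrier := K\<rparr>) (\<theta> ` Q) = {k \<in> K. finite (conjugates_by G Q k)}"
proof -
  have union: "finite_orbits_union (G\<lparr>carrier := K\<rparr>) (\<theta> ` Q) =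
      \<Union>{conjugates_by G Q x |x. x \<in> K \<and> finite (conjugates_by G Q x)}"
    by (auto simp: finite_orbits_union_def orbits_def theta_orbit_eq) (metis theta_orbit_eq)
  have self: "x \<in> conjugates_by G Q x" if "x \<in> K" for x
    using that by (auto simp: conjugates_by_def image_iff intro!: bexI[of _ \<one>])
  have "y \<in> K \<and> finite (conjugates_by G Q y)"
    if x: "x \<in> K" and fin: "finite (conjugates_by G Q x)" and y: "y \<in> conjugates_by G Q x" for x y
  proof -
    obtain q where q: "q \<in> Q" "y = q \<otimes> x \<otimes> inv q"
      using y by (auto simp: conjugates_by_def)
    have "r \<otimes> y \<otimes> inv r = (r \<otimes> q) \<otimes> x \<otimes> inv (r \<otimes> q)" if "r \<in> Q" for r
      using that q x by (simp add: K.m_assoc K.inv_mult_group)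
    then have "conjugates_by G Q y \<subseteq> conjugates_by G Q x"
      using q by (auto simp: conjugates_by_def)
    with fin q x show ?thesis
      using K.inv_op_closed2 by (auto intro: finite_subset)
  qed
  with self show ?thesis
    unfolding union by blast
qed

section \<open>The criterion\<close>

text \<open>
  An element centralized by \<open>K\<close> has a finite class as soon as its two components have finitely
  many conjugates by \<open>Q\<close>.
\<close>
lemma trivial_if_centralizes:
  assumes "icc G" "k \<in> K" "q \<in> Q" "centralizes G K (k \<otimes> q)"
    and "finite (conjugates_by G Q k)" "finite (conjugates_by G Q q)"
  shows "k = \<one> \<and> q = \<one>"
proof -
  have "finite (conjugates_by G (carrier G) (k \<otimes> q))"
    using assms K.finite_conjugates_by_if_centralizes[OF K.subset]
    by (simp add: finite_conjugates_by_product finite_conjugates_by_retract)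
  then have "k \<otimes> q = \<one> \<otimes> \<one>"
    using assms by (simp add: K.icc_iff)
  then show ?thesis
    using factorization_unique[of k \<one> q \<one>] assms by simp
qed

text \<open>
  The commutator of \<open>g\<close> and \<open>x\<close> is a product of \<open>g\<close> and a conjugate of its inverse, so its class is
  finite; it is also a product of elements of the normal subgroup \<open>K\<close>.
\<close>
lemma centralizes_if_finite_class:
  assumes triv: "\<And>k. \<lbrakk>k \<in> K; finite (conjugates_by G (carrier G) k)\<rbrakk> \<Longrightarrow> k = \<one>"
    and g: "g \<in> carrier G" "finite (conjugates_by G (carrier G) g)"
  shows "centralizes G K g"
  unfolding centralizes_def
proof
  fix x assume x: "x \<in> K"
  let ?c = "g \<otimes> (x \<otimes> inv g \<otimes> inv x)"
  have "finite (conjugates_by G (carrier G) ?c)"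
    using g x by (intro K.finite_conjugates_by_mult K.finite_conjugates_by_conj
        K.finite_conjugates_by_inv) simp_all
  moreover have "?c = (g \<otimes> x \<otimes> inv g) \<otimes> inv x"
    using g x by (simp add: K.m_assoc)
  then have "?c \<in> K"
    using g x K.inv_op_closed2 by simp
  ultimately have "?c = \<one>"
    by (rule triv[rotated])
  have "g \<otimes> x = ?c \<otimes> (x \<otimes> g)"
    using g x by (simp add: K.m_assoc K.cancel_left)
  with \<open>?c = \<one>\<close> show "g \<otimes> x = x \<otimes> g"
    using g x by simp
qed

text \<open>
  The right-hand side is (a), (b), (c) with \<open>\<theta>\<close> and \<open>\<pi>\<^sub>K\<close> eliminated in favour of conjugation in
  \<open>G\<close>; here \<open>F\<close> is \<open>FC(Q)\<close>. In this form all three conditions speak of elements of \<open>G\<close> alone.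
\<close>
lemma icc_iff_conjugates_by:
  assumes "carrier G \<noteq> {\<one>}"
  defines "F \<equiv> {q \<in> Q. finite (conjugates_by G Q q)}"
  shows "icc G \<longleftrightarrow>
    (\<forall>k\<in>K. finite (conjugates_by G Q k) \<longrightarrow> finite (conjugates_by G K k) \<longrightarrow> k = \<one>) \<and>
    (\<forall>k\<in>K. \<forall>q\<in>F. finite (conjugates_by G Q k) \<longrightarrow> centralizes G K (k \<otimes> inv q) \<longrightarrow> k = \<one>) \<and>
    (\<forall>p\<in>F. \<forall>q\<in>F. centralizes G K (p \<otimes> inv q) \<longrightarrow> p = q)"
    (is "_ \<longleftrightarrow> ?a \<and> ?b \<and> ?c")
proof
  have F_inv: "inv q \<in> F" if "q \<in> F" for q
    using that K.finite_conjugates_by_inv[OF Q.subset] by (simp add: F_def)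
  have F_mult: "p \<otimes> q \<in> F" if "p \<in> F" "q \<in> F" for p q
    using that K.finite_conjugates_by_mult[OF Q.subset] by (simp add: F_def)
  have fin_one: "finite (conjugates_by G Q \<one>)"
    by (rule K.finite_conjugates_by_one[OF Q.subset])
  {
    assume icc: "icc G"
    then have ?a
      by (simp add: K.icc_iff finite_conjugates_by_product)
    moreover have ?b
      using trivial_if_centralizes[OF icc] F_inv F_def by blast
    moreover have ?c
    proof (intro ballI impI)
      fix p q assume pq: "p \<in> F" "q \<in> F" "centralizes G K (p \<otimes> inv q)"
      then have r: "p \<otimes> inv q \<in> F"
        using F_mult F_inv by blast
      then have "p \<otimes> inv q = \<one>"
        using trivial_if_centralizes[OF icc, of \<one> "p \<otimes> inv q"] pq fin_one by (simp add: F_def)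
      then show "p = q"
        using pq K.inv_equality[of p "inv q"] by (simp add: F_def)
    qed
    ultimately show "?a \<and> ?b \<and> ?c"
      by blast
  }
  assume abc: "?a \<and> ?b \<and> ?c"
  have "g = \<one>" if g: "g \<in> carrier G" and fin: "finite (conjugates_by G (carrier G) g)" for g
  proof -
    have cent: "centralizes G K g"
      using abc g fin by (intro centralizes_if_finite_class) (auto simp: finite_conjugates_by_product)
    obtain k q where kq: "k \<in> K" "q \<in> Q" "g = k \<otimes> q"
      using g by (auto simp: set_mult_def simp flip: product_eq)
    then have "finite (conjugates_by G Q k)" and q: "q \<in> F"
      using fin g by (simp_all add: finite_conjugates_by_product finite_conjugates_by_retract F_def)
    \<comment> \<open>\<open>k\<close> and \<open>q\<inverse>\<close> act alike on \<open>K\<close>, whence the use of (b) for \<open>q\<inverse>\<close>.\<close>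
    then have "k = \<one>"
      using abc kq cent F_inv[OF q] by (metis K.inv_inv in_carrier(2))
    then have "centralizes G K (q \<otimes> inv \<one>)"
      using cent kq by simp
    moreover have "\<one> \<in> F"
      using fin_one by (simp add: F_def)
    ultimately have "q = \<one>"
      using abc q by blast
    with \<open>k = \<one>\<close> kq show ?thesis
      by simp
  qed
  then show "icc G"
    using assms by (simp add: K.icc_iff)
qed

end

theorem theorem2:
  fixes G :: "('a, 'm) monoid_scheme" and K Q :: "'a set" and \<theta> :: "'a \<Rightarrow> 'a \<Rightarrow> 'a"
  defines "KG \<equiv> G\<lparr>carrier := K\<rparr>" and "QG \<equiv> G\<lparr>carrier := Q\<rparr>"
  assumes "split_extension G K Q \<theta>"
    and "carrier G \<noteq> {\<one>\<^bsub>G\<^esub>}"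
  shows "icc G \<longleftrightarrow>
      finite_orbits_union KG (\<theta> ` Q) \<inter> FC KG = {\<one>\<^bsub>G\<^esub>} \<and>
      finite_orbits_union KG (\<theta> ` Q) \<inter> {k \<in> K. inner_aut KG k \<in> \<theta> ` FC QG} = {\<one>\<^bsub>G\<^esub>} \<and>
      inj_on \<theta> (FC QG)"
proof -
  interpret split_extension G K Q \<theta> by fact
  let ?F = "{q \<in> Q. finite (conjugates_by G Q q)}"
  let ?O = "{k \<in> K. finite (conjugates_by G Q k)}"
  have FCK: "FC KG = {x \<in> K. finite (conjugates_by G K x)}"
    unfolding KG_def by (rule K.FC_subgroup_eq[OF K.subgroup_axioms])
  have FCQ: "FC QG = ?F"
    unfolding QG_def by (rule K.FC_subgroup_eq[OF Q.subgroup_axioms])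
  have orbits: "finite_orbits_union KG (\<theta> ` Q) = ?O"
    unfolding KG_def by (rule finite_orbits_union_eq)
  have inner: "{k \<in> K. inner_aut KG k \<in> \<theta> ` FC QG} =
      {k \<in> K. \<exists>q\<in>?F. centralizes G K (k \<otimes>\<^bsub>G\<^esub> inv\<^bsub>G\<^esub> q)}"
    unfolding FCQ by (auto simp: KG_def image_iff inner_aut_eq_theta_iff)
  have inj: "inj_on \<theta> (FC QG) \<longleftrightarrow>
      (\<forall>p\<in>?F. \<forall>q\<in>?F. centralizes G K (p \<otimes>\<^bsub>G\<^esub> inv\<^bsub>G\<^esub> q) \<longrightarrow> p = q)"
    unfolding FCQ by (auto simp: inj_on_def theta_eq_theta_iff)
  have one: "finite (conjugates_by G Q \<one>\<^bsub>G\<^esub>)" "finite (conjugates_by G K \<one>\<^bsub>G\<^esub>)"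
    using K.finite_conjugates_by_one Q.subset K.subset by blast+
  have "centralizes G K (\<one>\<^bsub>G\<^esub> \<otimes>\<^bsub>G\<^esub> inv\<^bsub>G\<^esub> \<one>\<^bsub>G\<^esub>)"
    by (simp add: centralizes_def)
  then have one_inner: "\<exists>q\<in>?F. centralizes G K (\<one>\<^bsub>G\<^esub> \<otimes>\<^bsub>G\<^esub> inv\<^bsub>G\<^esub> q)"
    using one Q.one_closed by (intro bexI[of _ "\<one>\<^bsub>G\<^esub>"]) simp_all
  have a: "?O \<inter> FC KG = {\<one>\<^bsub>G\<^esub>} \<longleftrightarrow>
      (\<forall>k\<in>K. finite (conjugates_by G Q k) \<longrightarrow> finite (conjugates_by G K k) \<longrightarrow> k = \<one>\<^bsub>G\<^esub>)"
    unfolding FCK using one K.one_closed by (auto simp: set_eq_iff)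
  have b: "?O \<inter> {k \<in> K. inner_aut KG k \<in> \<theta> ` FC QG} = {\<one>\<^bsub>G\<^esub>} \<longleftrightarrow>
      (\<forall>k\<in>K. \<forall>q\<in>?F. finite (conjugates_by G Q k) \<longrightarrow>
        centralizes G K (k \<otimes>\<^bsub>G\<^esub> inv\<^bsub>G\<^esub> q) \<longrightarrow> k = \<one>\<^bsub>G\<^esub>)"
    unfolding inner using one one_inner K.one_closed by (auto simp: set_eq_iff)
  show ?thesis
    unfolding orbits a b inj by (rule icc_iff_conjugates_by[OF assms(4)])
qed

end
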